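(* Let $q\in\mathbb R$. The $q$-Minkowski plane contains the euclidean $q$-plane and the three-dimensional $q$-Minkowski plane, in the following sense. Let $\mathcal M_q$ be the $q$-Minkowski $*$-algebra and let $\mathcal E_q$, $\mathcal L_q$ be the quantum planes of $SO_q(3,\mathbb R)$ and $SO_q(2,1)$ respectively (as defined in the context). Then: 1. The quotient of $\mathcal M_q$ by the relation $x^2=x^3$ is isomorphic, as a $*$-algebra, to the euclidean $q$-plane $\mathcal E_q$, by identifying $x^1,\ \sqrt{q^{1/2}+q^{-1/2}}\;x^2,\ x^4$ with $y^1,y^2,y^3$ respectively. 2. The quotient of $\mathcal M_q$ by the relation $x^2=-x^3$ is isomorphic, as a $*$-algebra, to the three-dimensional $q$-Minkowski plane $\mathcal L_q$, by identifying $x^1,\ i\sqrt{q^{1/2}+q^{-1/2}}\;x^2,\ x^4$ with $y^1,y^2,y^3$ respectively.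
   Context: Superscripts on $x$ and $y$ are indices, not powers. $q\in\mathbb R$ is the (nonzero) deformation parameter and $q^{1/2}$ a square root of it. $\mathcal M_q$ is the unital complex algebra generated by $x^1,x^2,x^3,x^4$ with relations $x^1x^2=qx^2x^1$, $x^1x^3=qx^3x^1$, $x^2x^4=qx^4x^2$, $x^3x^4=qx^4x^3$, $x^2x^3=x^3x^2$, $x^1x^4=x^4x^1-(q-q^{-1})x^2x^3$, equipped with the antilinear antimultiplicative involution given by $(x^1)^*=q\,x^4$ (hence $(x^4)^*=q^{-1}x^1$), $(x^2)^*=x^2$, $(x^3)^*=x^3$. The $SO_q(3)$ quantum plane is the unital complex algebra generated by $y^1,y^2,y^3$ with relations $y^1y^2=qy^2y^1$, $y^2y^3=qy^3y^2$, $y^1y^3=y^3y^1-(q^{1/2}-q^{-1/2})y^2y^2$. With the antilinear antimultiplicative involution $(y^1)^*=q\,y^3$ (hence $(y^3)^*=q^{-1}y^1$), $(y^2)^*=y^2$ it is the euclidean plane $\mathcal E_q$ of $SO_q(3,\mathbb R)$; with $(y^1)^*=q\,y^3$ (hence $(y^3)^*=q^{-1}y^1$), $(y^2)^*=-y^2$ it is the plane $\mathcal L_q$ of $SO_q(2,1)$.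
   Formalization: Stated for q > 0 with the positive root q^{1/2}, not all real q: for q < 0 the involutions of E_q and L_q are incompatible with the relation for y^1y^3, and for q > 0 with the negative root the stated identification does not respect the involution. *)

theory Defs
  imports Complex_Main "HOL-Library.Poly_Mapping" "HOL-Algebra.Module" "HOL-Algebra.QuotRing"
begin

section \<open>Complex star-algebras\<close>

definition complex_ring :: "complex ring" where
  "complex_ring = \<lparr>carrier = UNIV, mult = (*), one = 1, zero = 0, add = (+)\<rparr>"

record 'a star_alg = "(complex, 'a) module" +
  star :: "'a \<Rightarrow> 'a"

text \<open>The locale \<^locale>\<open>algebra\<close> of the library is restricted to commutative algebras.\<close>

locale star_algebra = ring A + complex_module: module complex_ring A for A (structure) +
  assumes smult_mult_left: "\<lbrakk>x \<in> carrier A; y \<in> carrier A\<rbrakk>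
      \<Longrightarrow> (c \<odot>\<^bsub>A\<^esub> x) \<otimes>\<^bsub>A\<^esub> y = c \<odot>\<^bsub>A\<^esub> (x \<otimes>\<^bsub>A\<^esub> y)"
    and smult_mult_right: "\<lbrakk>x \<in> carrier A; y \<in> carrier A\<rbrakk>
      \<Longrightarrow> x \<otimes>\<^bsub>A\<^esub> (c \<odot>\<^bsub>A\<^esub> y) = c \<odot>\<^bsub>A\<^esub> (x \<otimes>\<^bsub>A\<^esub> y)"
    and star_closed: "x \<in> carrier A \<Longrightarrow> star A x \<in> carrier A"
    and star_add: "\<lbrakk>x \<in> carrier A; y \<in> carrier A\<rbrakk>
      \<Longrightarrow> star A (x \<oplus>\<^bsub>A\<^esub> y) = star A x \<oplus>\<^bsub>A\<^esub> star A y"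
    and star_smult: "x \<in> carrier A \<Longrightarrow> star A (c \<odot>\<^bsub>A\<^esub> x) = cnj c \<odot>\<^bsub>A\<^esub> star A x"
    and star_mult: "\<lbrakk>x \<in> carrier A; y \<in> carrier A\<rbrakk>
      \<Longrightarrow> star A (x \<otimes>\<^bsub>A\<^esub> y) = star A y \<otimes>\<^bsub>A\<^esub> star A x"
    and star_star: "x \<in> carrier A \<Longrightarrow> star A (star A x) = x"

definition star_alg_iso ::
  "('a, 'm) star_alg_scheme \<Rightarrow> ('b, 'n) star_alg_scheme \<Rightarrow> ('a \<Rightarrow> 'b) set" where
  "star_alg_iso A B = {f. star_algebra A \<and> star_algebra B \<and> f \<in> ring_iso A B \<and>
     (\<forall>c. \<forall>x\<in>carrier A. f (c \<odot>\<^bsub>A\<^esub> x) = c \<odot>\<^bsub>B\<^esub> f x) \<and>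
     (\<forall>x\<in>carrier A. f (star A x) = star B (f x))}"

text \<open>
  Scalar multiplication and star on cosets are defined in the style of
  \<^const>\<open>rcoset_mult\<close>, without choosing representatives. If the star of \<open>A\<close> does not map
  the two-sided ideal \<open>I\<close> into itself, then \<open>star\<close> of a coset fails to be a coset, so that the
  quotient does not satisfy \<^locale>\<open>star_algebra\<close>.
\<close>

definition star_quot :: "('a, 'm) star_alg_scheme \<Rightarrow> 'a set \<Rightarrow> 'a set star_alg" where
  "star_quot A I =
    \<lparr>carrier = carrier (A Quot I), mult = mult (A Quot I), one = one (A Quot I),
     zero = zero (A Quot I), add = add (A Quot I),
     smult = (\<lambda>c X. \<Union>x\<in>X. I +>\<^bsub>A\<^esub> (c \<odot>\<^bsub>A\<^esub> x)),
     star = (\<lambda>X. \<Union>x\<in>X. I +>\<^bsub>A\<^esub> star A x)\<rparr>"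

definition rel_ideal :: "('a, 'm) star_alg_scheme \<Rightarrow> 'a \<Rightarrow> 'a \<Rightarrow> 'a set" where
  "rel_ideal A a b = Idl\<^bsub>A\<^esub> {a \<ominus>\<^bsub>A\<^esub> b}"


section \<open>Free algebras and presentations\<close>

datatype 'g free_monoid = Word (letters: "'g list")

instantiation free_monoid :: (type) monoid_add
begin

definition "0 = Word []"
definition "v + w = Word (letters v @ letters w)"

instance
  by standard (simp_all add: zero_free_monoid_def plus_free_monoid_def)

end

text \<open>The free unital complex algebra is the monoid algebra of the free monoid.\<close>

type_synonym 'g free_alg = "'g free_monoid \<Rightarrow>\<^sub>0 complex"

definition scal :: "complex \<Rightarrow> 'g free_alg" where
  "scal c = Poly_Mapping.single 0 c"

definition gen :: "'g \<Rightarrow> 'g free_alg" where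
  "gen x = Poly_Mapping.single (Word [x]) 1"

text \<open>The antilinear antimultiplicative extension of the map \<open>s\<close> on generators.\<close>

definition star_ext :: "('g \<Rightarrow> 'g free_alg) \<Rightarrow> 'g free_alg \<Rightarrow> 'g free_alg" where
  "star_ext s p = (\<Sum>w\<in>Poly_Mapping.keys p.
     scal (cnj (Poly_Mapping.lookup p w)) * prod_list (map s (rev (letters w))))"

definition free_star_alg :: "('g \<Rightarrow> 'g free_alg) \<Rightarrow> 'g free_alg star_alg" where
  "free_star_alg s =
    \<lparr>carrier = UNIV, mult = (*), one = 1, zero = 0, add = (+),
     smult = (\<lambda>c p. scal c * p), star = star_ext s\<rparr>"

text \<open>
  In a presentation, the set \<open>R\<close> consists of the elements \<open>l - r\<close> for the relations \<open>l = r\<close>.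
\<close>

definition presented_star_alg ::
  "('g \<Rightarrow> 'g free_alg) \<Rightarrow> 'g free_alg set \<Rightarrow> 'g free_alg set star_alg" where
  "presented_star_alg s R = star_quot (free_star_alg s) (Idl\<^bsub>free_star_alg s\<^esub> R)"

definition presented_gen ::
  "('g \<Rightarrow> 'g free_alg) \<Rightarrow> 'g free_alg set \<Rightarrow> 'g \<Rightarrow> 'g free_alg set" where
  "presented_gen s R x = (Idl\<^bsub>free_star_alg s\<^esub> R) +>\<^bsub>free_star_alg s\<^esub> gen x"


section \<open>The q-Minkowski algebra\<close>

datatype xgen = X1 | X2 | X3 | X4

definition mink_rels :: "real \<Rightarrow> xgen free_alg set" where
  "mink_rels q =
    {gen X1 * gen X2 - scal q * gen X2 * gen X1,
     gen X1 * gen X3 - scal q * gen X3 * gen X1,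
     gen X2 * gen X4 - scal q * gen X4 * gen X2,
     gen X3 * gen X4 - scal q * gen X4 * gen X3,
     gen X2 * gen X3 - gen X3 * gen X2,
     gen X1 * gen X4 - (gen X4 * gen X1 - scal (q - inverse q) * gen X2 * gen X3)}"

fun mink_star :: "real \<Rightarrow> xgen \<Rightarrow> xgen free_alg" where
  "mink_star q X1 = scal q * gen X4"
| "mink_star q X2 = gen X2"
| "mink_star q X3 = gen X3"
| "mink_star q X4 = scal (inverse q) * gen X1"

definition mink_plane :: "real \<Rightarrow> xgen free_alg set star_alg" where
  "mink_plane q = presented_star_alg (mink_star q) (mink_rels q)"

definition mink_x :: "real \<Rightarrow> xgen \<Rightarrow> xgen free_alg set" where
  "mink_x q = presented_gen (mink_star q) (mink_rels q)"


section \<open>The quantum planes of SOq(3,R) and SOq(2,1)\<close>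

datatype ygen = Y1 | Y2 | Y3

text \<open>
  The square root of \<open>q\<close> is the real one. It is meant for \<open>q > 0\<close> only: applying the involution
  to the last relation shows that the involution is compatible with the relations only if the
  coefficient of \<open>y2 y2\<close> is real, which fails for \<open>q < 0\<close>, where both square roots of \<open>q\<close>
  are imaginary (while \<^const>\<open>sqrt\<close> is negative there).
\<close>

definition so3_rels :: "real \<Rightarrow> ygen free_alg set" where
  "so3_rels q =
    {gen Y1 * gen Y2 - scal q * gen Y2 * gen Y1,
     gen Y2 * gen Y3 - scal q * gen Y3 * gen Y2,
     gen Y1 * gen Y3 -
       (gen Y3 * gen Y1 - scal (sqrt q - inverse (sqrt q)) * gen Y2 * gen Y2)}"

fun eucl_star :: "real \<Rightarrow> ygen \<Rightarrow> ygen free_alg" where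
  "eucl_star q Y1 = scal q * gen Y3"
| "eucl_star q Y2 = gen Y2"
| "eucl_star q Y3 = scal (inverse q) * gen Y1"

fun lor_star :: "real \<Rightarrow> ygen \<Rightarrow> ygen free_alg" where
  "lor_star q Y1 = scal q * gen Y3"
| "lor_star q Y2 = - gen Y2"
| "lor_star q Y3 = scal (inverse q) * gen Y1"

definition eucl_plane :: "real \<Rightarrow> ygen free_alg set star_alg" where
  "eucl_plane q = presented_star_alg (eucl_star q) (so3_rels q)"

definition eucl_y :: "real \<Rightarrow> ygen \<Rightarrow> ygen free_alg set" where
  "eucl_y q = presented_gen (eucl_star q) (so3_rels q)"

definition lor_plane :: "real \<Rightarrow> ygen free_alg set star_alg" where
  "lor_plane q = presented_star_alg (lor_star q) (so3_rels q)"

definition lor_y :: "real \<Rightarrow> ygen \<Rightarrow> ygen free_alg set" where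
  "lor_y q = presented_gen (lor_star q) (so3_rels q)"

end

(* The substitutions x1, x2, x3, x4 -> y1, y2/k, e y2/k, y3 and y1, y2, y3 -> x1, k x2, x4 commute
   with the involutions of the free algebras and respect the relations; for the last relation this
   is the identity (q^(1/2) + q^(-1/2)) (q^(1/2) - q^(-1/2)) = q - 1/q. By the universal properties
   of presentations and quotients they descend to star-homomorphisms in both directions, which are
   mutually inverse because they are so on generators. *)

theory Submission
  imports Defs
begin

section \<open>Star-ideals and quotients\<close>

text \<open>Where the constants come from: let \<open>e\<close> be 1 or -1 and impose
  \<open>x2 = e x3\<close>. Then \<open>x3 = e x2\<close>, and the last Minkowski relation carries
  the term \<open>(q - 1/q) e x2 x2\<close>. With \<open>y2 = k x2\<close>, the term
  \<open>(q^(1/2) - q^(-1/2)) y2 y2\<close> of the other side becomes equal to it when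
  \<open>k k = e (q^(1/2) + q^(-1/2))\<close>. The involution asks for a compatible phase:
  \<open>x2\<close> is self-adjoint, so the star of \<open>k x2\<close> is \<open>cnj k x2\<close>,
  which has to be \<open>e k x2\<close>. Hence \<open>k\<close> is real for \<open>e = 1\<close> and
  imaginary for \<open>e = -1\<close>. No basis of any of the algebras is computed. Injectivity
  comes from the explicit inverse, so the algebra is reduced to the membership of finitely many
  explicit elements in ideals of free algebras. Every ideal must moreover be stable under the star,
  or the quotient has no involution. For the Minkowski relations this is more than a permutation up
  to scalars: reversing \<open>x2 x3\<close> in the last relation costs a multiple of the commutator
  of \<open>x2\<close> and \<open>x3\<close>.\<close>

lemma carrier_complex_ring [simp]: "carrier complex_ring = UNIV"
  and mult_complex_ring [simp]: "mult complex_ring = (*)"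
  and add_complex_ring [simp]: "add complex_ring = (+)"
  and one_complex_ring [simp]: "one complex_ring = 1"
  and zero_complex_ring [simp]: "zero complex_ring = 0"
  by (simp_all add: complex_ring_def)

lemma cring_complex_ring: "cring complex_ring"
proof (rule cringI)
  show "abelian_group complex_ring"
  proof (rule abelian_groupI)
    show "\<exists>y\<in>carrier complex_ring. y \<oplus>\<^bsub>complex_ring\<^esub> x = \<zero>\<^bsub>complex_ring\<^esub>" for x
      by (rule bexI[of _ "- x"]) simp_all
  qed (simp_all add: add.assoc add.commute)
  show "comm_monoid complex_ring"
    by (rule comm_monoidI) (auto simp: complex_ring_def)
qed (simp add: complex_ring_def distrib_right)

locale star_ideal = star_algebra A + ideal I A for I and A (structure) +
  assumes star_mem: "x \<in> I \<Longrightarrow> star A x \<in> I"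
begin

lemma smult_carrier [simp, intro]: "x \<in> carrier A \<Longrightarrow> c \<odot> x \<in> carrier A"
  by (simp add: complex_module.smult_closed)

text \<open>In a unital algebra scaling is multiplication by a multiple of the unit, so stability of
  the ideal under scalars comes for free and only stability under the star is an assumption of the
  locale.\<close>

lemma smult_mem: "x \<in> I \<Longrightarrow> c \<odot> x \<in> I"
proof -
  assume x: "x \<in> I"
  have "c \<odot> x = (c \<odot> \<one>) \<otimes> x" using x by (simp add: smult_mult_left)
  then show ?thesis using x by (simp add: I_l_closed)
qed

text \<open>Additivity is what scaling and the star have in common. An additive map preserving
  \<open>I\<close> sends a whole coset into one coset, so the unions in \<open>star_quot\<close>
  collapse to the coset of any representative.\<close>

lemma UN_coset_additive:
  assumes a: "a \<in> carrier A"
    and f: "\<And>x. x \<in> carrier A \<Longrightarrow> f x \<in> carrier A" "\<And>x. x \<in> I \<Longrightarrow> f x \<in> I"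
      "\<And>x y. \<lbrakk>x \<in> carrier A; y \<in> carrier A\<rbrakk> \<Longrightarrow> f (x \<oplus> y) = f x \<oplus> f y"
  shows "(\<Union>x\<in>I +> a. I +> f x) = I +> f a"
proof -
  have "I +> f x = I +> f a" if "x \<in> I +> a" for x
  proof -
    from that obtain h where h: "h \<in> I" "x = h \<oplus> a" by (auto simp: a_r_coset_def')
    then have "f x = f h \<oplus> f a" using a f(3) by simp
    then have "f x \<in> I +> f a" using f(2) h by (auto simp: a_r_coset_def')
    then show ?thesis by (rule a_repr_independence[symmetric, OF _ _ a_subgroup]) (use a f in auto)
  qed
  moreover have "I +> a \<noteq> {}" using a a_rcos_self by blast
  ultimately show ?thesis by auto
qed

lemma star_quot_simps:
  "carrier (star_quot A I) = (\<lambda>x. I +> x) ` carrier A"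
  "one (star_quot A I) = I +> \<one>"
  "zero (star_quot A I) = I"
  "\<lbrakk>x \<in> carrier A; y \<in> carrier A\<rbrakk> \<Longrightarrow> (I +> x) \<otimes>\<^bsub>star_quot A I\<^esub> (I +> y) = I +> (x \<otimes> y)"
  "\<lbrakk>x \<in> carrier A; y \<in> carrier A\<rbrakk> \<Longrightarrow> (I +> x) \<oplus>\<^bsub>star_quot A I\<^esub> (I +> y) = I +> (x \<oplus> y)"
  "x \<in> carrier A \<Longrightarrow> c \<odot>\<^bsub>star_quot A I\<^esub> (I +> x) = I +> (c \<odot> x)"
  "x \<in> carrier A \<Longrightarrow> star (star_quot A I) (I +> x) = I +> star A x"
proof -
  show "c \<odot>\<^bsub>star_quot A I\<^esub> (I +> x) = I +> (c \<odot> x)" if "x \<in> carrier A"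
    using that by (simp add: star_quot_def UN_coset_additive smult_mem complex_module.smult_r_distr)
  show "star (star_quot A I) (I +> x) = I +> star A x" if "x \<in> carrier A"
    using that by (simp add: star_quot_def UN_coset_additive star_mem star_add star_closed)
qed (auto simp: star_quot_def FactRing_simps rcoset_mult_add a_rcos_sum)

lemma coset_mem: "x \<in> I \<Longrightarrow> I +> x = \<zero>\<^bsub>star_quot A I\<^esub>"
  by (simp add: star_quot_simps a_coset_join2 a_subgroup)

lemma ring_star_quot: "ring (star_quot A I)"
proof (rule ringI)
  \<comment> \<open>With zero written as a coset too, and the library rule that would undo this
    removed, each ring law reduces to the same law for representatives.\<close>
  have zero: "zero (star_quot A I) = I +> \<zero>" by (simp add: star_quot_simps a_subset)
  note [simp] = star_quot_simps(1,2,4,5) zero and [simp del] = a_coset_add_zero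
  show "abelian_group (star_quot A I)"
  proof (rule abelian_groupI)
    fix X assume "X \<in> carrier (star_quot A I)"
    then obtain x where x: "x \<in> carrier A" "X = I +> x" by auto
    then show "\<exists>Y\<in>carrier (star_quot A I). Y \<oplus>\<^bsub>star_quot A I\<^esub> X = \<zero>\<^bsub>star_quot A I\<^esub>"
      by (intro bexI[of _ "I +> \<ominus> x"]) (simp_all add: l_neg)
  qed (auto simp: a_assoc a_comm a_lcomm)
  show "Group.monoid (star_quot A I)"
    by (rule monoidI) (auto simp: m_assoc)
qed (auto simp: star_quot_simps l_distr r_distr)

lemma star_algebra_star_quot: "star_algebra (star_quot A I)"
proof -
  interpret Q: ring "star_quot A I" by (rule ring_star_quot)
  note [simp] = star_quot_simps complex_module.smult_l_distr[simplified] complex_module.smult_r_distr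
     complex_module.smult_assoc1[simplified] star_closed star_add star_smult star_mult star_star
     smult_mult_left smult_mult_right
  have "module complex_ring (star_quot A I)"
    by (rule moduleI[OF cring_complex_ring Q.is_abelian_group]) (auto simp: complex_module.smult_one[simplified])
  then show ?thesis
    by (intro star_algebra.intro star_algebra_axioms.intro Q.ring_axioms) auto
qed

end

section \<open>Star-homomorphisms, factorization through quotients, star-stable ideals\<close>

definition star_hom ::
  "('a, 'm) star_alg_scheme \<Rightarrow> ('b, 'n) star_alg_scheme \<Rightarrow> ('a \<Rightarrow> 'b) set" where
  "star_hom A B = {f. f \<in> ring_hom A B \<and>
     (\<forall>c. \<forall>x\<in>carrier A. f (c \<odot>\<^bsub>A\<^esub> x) = c \<odot>\<^bsub>B\<^esub> f x) \<and>
     (\<forall>x\<in>carrier A. f (star A x) = star B (f x))}"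

lemma star_hom_comp: "\<lbrakk>f \<in> star_hom A B; g \<in> star_hom B C\<rbrakk> \<Longrightarrow> g \<circ> f \<in> star_hom A C"
  by (auto simp: star_hom_def ring_hom_closed[of f A B] intro: ring_hom_trans)

text \<open>A two-sided inverse replaces separate proofs of injectivity and surjectivity.\<close>

lemma star_alg_isoI:
  assumes "star_algebra A" "star_algebra B" "f \<in> star_hom A B" "g \<in> star_hom B A"
    and "\<And>x. x \<in> carrier A \<Longrightarrow> g (f x) = x" "\<And>y. y \<in> carrier B \<Longrightarrow> f (g y) = y"
  shows "f \<in> star_alg_iso A B"
proof -
  have "bij_betw f (carrier A) (carrier B)"
    by (rule bij_betw_byWitness[where f' = g])
      (use assms in \<open>auto simp: star_hom_def intro: ring_hom_closed\<close>)
  then show ?thesis using assms by (auto simp: star_alg_iso_def star_hom_def ring_iso_def)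
qed

context star_ideal
begin

lemma coset_star_hom: "(+>) I \<in> star_hom A (star_quot A I)"
  unfolding star_hom_def by (auto simp: star_quot_simps intro!: ring_hom_memI)

text \<open>Meaningful only if \<open>f\<close> is constant on cosets: \<^const>\<open>the_elem\<close> of a non-singleton is unspecified.\<close>

definition lift :: "('a \<Rightarrow> 'd) \<Rightarrow> 'a set \<Rightarrow> 'd" where
  "lift f X = the_elem (f ` X)"

lemma lift_coset:
  assumes f: "f \<in> star_hom A B" and B: "star_algebra B"
    and zero: "\<And>x. x \<in> I \<Longrightarrow> f x = \<zero>\<^bsub>B\<^esub>" and a: "a \<in> carrier A"
  shows "lift f (I +> a) = f a"
proof -
  interpret B: star_algebra B by (rule B)
  have hom: "f \<in> ring_hom A B" using f by (simp add: star_hom_def)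
  have "f x = f a" if x: "x \<in> I +> a" for x
  proof -
    from x obtain h where h: "h \<in> I" "x = h \<oplus> a" by (auto simp: a_r_coset_def')
    then show ?thesis using zero a ring_hom_add[OF hom, of h a] ring_hom_closed[OF hom, of a] by simp
  qed
  moreover have "a \<in> I +> a" using a by (rule a_rcos_self)
  ultimately have "f ` (I +> a) = {f a}" by blast
  then show ?thesis by (simp add: lift_def)
qed

lemma lift_star_hom:
  assumes f: "f \<in> star_hom A B" and B: "star_algebra B"
    and zero: "\<And>x. x \<in> I \<Longrightarrow> f x = \<zero>\<^bsub>B\<^esub>"
  shows "lift f \<in> star_hom (star_quot A I) B"
proof -
  note lift = lift_coset[OF assms]
  have hom: "f \<in> ring_hom A B" using f by (simp add: star_hom_def)
  show ?thesis
    using f unfolding star_hom_def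
    by (auto intro!: ring_hom_memI
        simp: lift star_quot_simps star_closed ring_hom_closed[OF hom] ring_hom_mult[OF hom]
          ring_hom_add[OF hom] ring_hom_one[OF hom])
qed

end

text \<open>The kernel is an ideal containing \<open>S\<close>, hence contains the ideal generated
  by \<open>S\<close>. Vanishing thus needs checking on the relations only.\<close>

lemma star_hom_genideal_zero:
  assumes A: "star_algebra A" and B: "star_algebra B" and f: "f \<in> star_hom A B"
    and S: "S \<subseteq> carrier A" "\<And>x. x \<in> S \<Longrightarrow> f x = \<zero>\<^bsub>B\<^esub>" and x: "x \<in> Idl\<^bsub>A\<^esub> S"
  shows "f x = \<zero>\<^bsub>B\<^esub>"
proof -
  have ring: "ring A" "ring B" using A B by (simp_all add: star_algebra.axioms(1))
  have "f \<in> ring_hom A B" using f by (simp add: star_hom_def)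
  then have "ideal (a_kernel A B f) A"
    by (intro ring_hom_ring.kernel_is_ideal ring_hom_ringI2 ring)
  then have "Idl\<^bsub>A\<^esub> S \<subseteq> a_kernel A B f"
    using S by (intro ring.genideal_minimal[OF ring(1)]) (auto simp: a_kernel_def')
  then show ?thesis using x by (auto simp: a_kernel_def')
qed

lemma (in star_algebra) star_zero: "star A \<zero> = \<zero>"
  using star_add[of \<zero> \<zero>] star_closed[of \<zero>] by simp

lemma (in star_algebra) star_minus: "x \<in> carrier A \<Longrightarrow> star A (\<ominus> x) = \<ominus> star A x"
  by (metis a_inv_closed l_neg minus_equality star_add star_closed star_zero)

text \<open>The elements whose star lies in \<open>Idl S\<close> form a two-sided ideal, because the
  star exchanges left and right multiples. It contains \<open>S\<close>, hence all of
  \<open>Idl S\<close>.\<close>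

lemma (in star_algebra) star_ideal_genideal:
  assumes S: "S \<subseteq> carrier A" "\<And>x. x \<in> S \<Longrightarrow> star A x \<in> Idl S"
  shows "star_ideal (Idl S) A"
proof -
  interpret I: ideal "Idl S" A by (rule genideal_ideal[OF S(1)])
  have "ideal {x \<in> carrier A. star A x \<in> Idl S} A"
  proof (intro idealI[OF ring_axioms] add.subgroupI)
    have "\<zero> \<in> {x \<in> carrier A. star A x \<in> Idl S}" by (simp add: star_zero)
    then show "{x \<in> carrier A. star A x \<in> Idl S} \<noteq> {}" by blast
  qed (auto simp: star_add star_mult star_minus I.I_l_closed I.I_r_closed star_closed simp flip: a_inv_def)
  then have "Idl S \<subseteq> {x \<in> carrier A. star A x \<in> Idl S}"
    by (rule genideal_minimal) (use S in auto)
  then show ?thesis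
    by (intro star_ideal.intro star_ideal_axioms.intro star_algebra_axioms I.is_ideal) auto
qed


section \<open>Free algebras\<close>

lemma scal_0 [simp]: "scal 0 = 0"
  and scal_1 [simp]: "scal 1 = 1"
  and scal_add: "scal (a + b) = scal a + scal b"
  and scal_diff: "scal (a - b) = scal a - scal b"
  and scal_minus: "scal (- a) = - scal a"
  and scal_mult: "scal a * scal b = scal (a * b)"
  by (simp_all add: scal_def single_add single_diff single_uminus mult_single)

lemma scal_mult_left: "scal a * (scal b * p) = scal (a * b) * p"
  by (simp add: scal_mult flip: mult.assoc)

lemma free_alg_single_induct [case_names zero single add]:
  assumes "P 0" "\<And>w c. P (Poly_Mapping.single w c)" "\<And>p q. \<lbrakk>P p; P q\<rbrakk> \<Longrightarrow> P (p + q)"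
  shows "P (p :: 'g free_alg)"
proof (induction p rule: update_induct)
  case (update p w c)
  \<comment> \<open>The word \<open>w\<close> is not a key of \<open>p\<close>, so overwriting its
    coefficient amounts to adding a monomial.\<close>
  have "Poly_Mapping.update w c p = p + Poly_Mapping.single w c"
    using update.hyps(1)
    by (intro poly_mapping_eqI) (auto simp: lookup_update lookup_add lookup_single in_keys_iff)
  then show ?case using assms update by metis
qed (rule assms)

text \<open>Scalars sit on the empty word, which is neutral on both sides, so they are
  central.\<close>

lemma scal_commute: "p * scal c = scal c * p"
  by (induction p rule: free_alg_single_induct)
    (simp_all add: scal_def mult_single distrib_left distrib_right mult.commute)

lemma scal_left_commute: "p * (scal c * r) = scal c * (p * r)"
  by (metis mult.assoc scal_commute)

text \<open>The commutation rules are instantiated at generators so that they only move scalars to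
  the front; a general left factor could itself be a scalar.\<close>

lemmas scal_simps =
  scal_mult scal_mult_left scal_commute[of "gen x" for x] scal_left_commute[of "gen x" for x]

text \<open>The ring is generated by scalars and letters: each monomial is built by prepending
  letters one at a time. This is what reduces identities between (anti)multiplicative maps to
  generators.\<close>

lemma free_alg_induct [case_names scal gen mult add]:
  assumes scal: "\<And>c. P (scal c)" and gen: "\<And>x. P (gen x)"
    and mult: "\<And>p q. \<lbrakk>P p; P q\<rbrakk> \<Longrightarrow> P (p * q)" and add: "\<And>p q. \<lbrakk>P p; P q\<rbrakk> \<Longrightarrow> P (p + q)"
  shows "P p"
proof (induction p rule: free_alg_single_induct)
  case zero
  show ?case using scal[of 0] by simp
next
  case (single w c)
  have "P (Poly_Mapping.single (Word u) c)" for u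
  proof (induction u)
    case Nil
    show ?case using scal[of c] by (simp add: scal_def zero_free_monoid_def)
  next
    case (Cons x u)
    have "Poly_Mapping.single (Word (x # u)) c = gen x * Poly_Mapping.single (Word u) c"
      by (simp add: gen_def mult_single plus_free_monoid_def)
    then show ?case using mult gen Cons by simp
  qed
  then show ?case by (cases w) simp
qed (rule add)

text \<open>Common form of the two extensions from words: \<open>h\<close> is \<open>cnj\<close> for
  the star and the identity for substitutions.\<close>

definition semilin :: "(complex \<Rightarrow> complex) \<Rightarrow> ('g free_monoid \<Rightarrow> 'h free_alg) \<Rightarrow> 'g free_alg \<Rightarrow> 'h free_alg"
  where "semilin h m p = (\<Sum>w\<in>Poly_Mapping.keys p. scal (h (Poly_Mapping.lookup p w)) * m w)"

context
  fixes h :: "complex \<Rightarrow> complex"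
  assumes h: "h 0 = 0" "\<And>a b. h (a + b) = h a + h b" "\<And>a b. h (a * b) = h a * h b"
begin

lemma semilin_single: "semilin h m (Poly_Mapping.single w c) = scal (h c) * m w"
  by (simp add: semilin_def h)

text \<open>Since \<open>h 0 = 0\<close>, extra words contribute nothing. In
  \<open>semilin_add\<close> this puts \<open>p\<close>, \<open>q\<close> and \<open>p + q\<close>
  over one index set even when coefficients cancel.\<close>

lemma semilin_superset:
  assumes "finite S" "Poly_Mapping.keys p \<subseteq> S"
  shows "semilin h m p = (\<Sum>w\<in>S. scal (h (Poly_Mapping.lookup p w)) * m w)"
  unfolding semilin_def using assms by (intro sum.mono_neutral_left) (auto simp: in_keys_iff h)

lemma semilin_add: "semilin h m (p + q) = semilin h m p + semilin h m q"
proof -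
  let ?S = "Poly_Mapping.keys p \<union> Poly_Mapping.keys q"
  have "finite ?S" "Poly_Mapping.keys (p + q) \<subseteq> ?S" by (auto dest: subsetD[OF keys_add])
  then show ?thesis
    by (simp add: semilin_superset[of ?S] lookup_add h scal_add distrib_right sum.distrib)
qed

lemma semilin_0: "semilin h m 0 = 0"
  by (simp add: semilin_def)

lemma semilin_scal: "m 0 = 1 \<Longrightarrow> semilin h m (scal c) = scal (h c)"
  by (simp add: scal_def[of c] semilin_single)

text \<open>Both sides are additive in each factor, so a double induction leaves only products of
  two monomials.\<close>

lemma semilin_mult:
  assumes m: "\<And>v w. m (v + w) = m v * m w"
  shows "semilin h m (p * q) = semilin h m p * semilin h m q"
proof (induction p rule: free_alg_single_induct)
  case (single v a)
  show ?case
    by (induction q rule: free_alg_single_induct)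
      (simp_all add: semilin_0 semilin_add semilin_single mult_single distrib_left m h
        mult.assoc scal_mult_left scal_left_commute[of "m v"])
qed (simp_all add: semilin_0 semilin_add distrib_right)

lemma semilin_mult_rev:
  assumes m: "\<And>v w. m (v + w) = m w * m v"
  shows "semilin h m (p * q) = semilin h m q * semilin h m p"
proof (induction p rule: free_alg_single_induct)
  case (single v a)
  show ?case
    by (induction q rule: free_alg_single_induct)
      (simp_all add: semilin_0 semilin_add semilin_single mult_single distrib_left distrib_right m h
        mult.assoc mult.commute[of "h a"] scal_mult_left scal_left_commute[of "m w" for w])
qed (simp_all add: semilin_0 semilin_add distrib_left distrib_right)

end

lemma star_ext_semilin: "star_ext s = semilin cnj (\<lambda>w. prod_list (map s (rev (letters w))))"
  by (simp add: fun_eq_iff star_ext_def semilin_def)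

lemma star_ext_add: "star_ext s (p + q) = star_ext s p + star_ext s q"
  and star_ext_mult: "star_ext s (p * q) = star_ext s q * star_ext s p"
  and star_ext_scal: "star_ext s (scal c) = scal (cnj c)"
  and star_ext_gen: "star_ext s (gen x) = s x"
  by (simp_all add: star_ext_semilin semilin_add semilin_mult_rev semilin_scal gen_def semilin_single
      plus_free_monoid_def zero_free_monoid_def)

lemma star_ext_minus: "star_ext s (- p) = - star_ext s p"
  using star_ext_add[of s "- p" p] star_ext_scal[of s 0] by (simp add: eq_neg_iff_add_eq_0)

lemma star_ext_diff: "star_ext s (p - q) = star_ext s p - star_ext s q"
  using star_ext_add[of s p "- q"] by (simp add: star_ext_minus)

lemmas star_ext_simps = star_ext_add star_ext_mult star_ext_scal star_ext_gen star_ext_minus star_ext_diff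

definition subst :: "('g \<Rightarrow> 'h free_alg) \<Rightarrow> 'g free_alg \<Rightarrow> 'h free_alg" where
  "subst t = semilin (\<lambda>c. c) (\<lambda>w. prod_list (map t (letters w)))"

lemma subst_add: "subst t (p + q) = subst t p + subst t q"
  and subst_mult: "subst t (p * q) = subst t p * subst t q"
  and subst_scal: "subst t (scal c) = scal c"
  and subst_gen: "subst t (gen x) = t x"
  by (simp_all add: subst_def semilin_add semilin_mult semilin_scal gen_def semilin_single
      plus_free_monoid_def zero_free_monoid_def)

lemma subst_minus: "subst t (- p) = - subst t p"
  using subst_add[of t "- p" p] subst_scal[of t 0] by (simp add: eq_neg_iff_add_eq_0)

lemma subst_diff: "subst t (p - q) = subst t p - subst t q"
  using subst_add[of t p "- q"] by (simp add: subst_minus)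

lemmas subst_simps = subst_add subst_mult subst_scal subst_gen subst_minus subst_diff

section \<open>The free star-algebra and its maps\<close>

lemma free_star_alg_simps [simp]:
  "carrier (free_star_alg s) = UNIV" "mult (free_star_alg s) = (*)" "one (free_star_alg s) = 1"
  "zero (free_star_alg s) = 0" "add (free_star_alg s) = (+)"
  "smult (free_star_alg s) = (\<lambda>c p. scal c * p)" "star (free_star_alg s) = star_ext s"
  by (simp_all add: free_star_alg_def)

lemma ring_free_star_alg: "ring (free_star_alg s)"
proof (rule ringI)
  show "abelian_group (free_star_alg s)"
  proof (rule abelian_groupI)
    show "\<exists>y\<in>carrier (free_star_alg s). y \<oplus>\<^bsub>free_star_alg s\<^esub> x = \<zero>\<^bsub>free_star_alg s\<^esub>" for x
      by (rule bexI[of _ "- x"]) simp_all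
  qed (simp_all add: add.assoc add.commute)
  show "Group.monoid (free_star_alg s)"
    by (rule monoidI) (simp_all add: mult.assoc)
qed (simp_all add: distrib_left distrib_right)

lemma a_minus_free_star_alg [simp]: "a_minus (free_star_alg s) p q = p - q"
  and a_inv_free_star_alg [simp]: "a_inv (free_star_alg s) p = - p"
proof -
  interpret ring "free_star_alg s" by (rule ring_free_star_alg)
  show inv: "a_inv (free_star_alg s) p = - p" for p
    by (rule minus_equality) simp_all
  show "a_minus (free_star_alg s) p q = p - q"
    by (simp add: a_minus_def inv)
qed

text \<open>Applying the star twice is linear and multiplicative, so it is the identity as soon as
  it fixes the generators.\<close>

lemma star_algebra_free_star_alg:
  assumes s: "\<And>x. star_ext s (s x) = gen x"
  shows "star_algebra (free_star_alg s)"
proof -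
  interpret ring "free_star_alg s" by (rule ring_free_star_alg)
  have "star_ext s (star_ext s p) = p" for p
    by (induction p rule: free_alg_induct) (simp_all add: star_ext_simps s)
  moreover have "module complex_ring (free_star_alg s)"
    by (rule moduleI[OF cring_complex_ring is_abelian_group])
      (simp_all add: scal_add scal_mult_left distrib_left distrib_right)
  ultimately show ?thesis
    by (intro star_algebra.intro star_algebra_axioms.intro ring_axioms)
      (simp_all add: star_ext_simps scal_left_commute mult.assoc scal_commute[of "star_ext s p" for p])
qed

text \<open>Both composites of substitution and star are antilinear and reverse products, so
  agreement on generators is enough.\<close>

lemma subst_star_hom:
  assumes "\<And>x. star_ext s' (t x) = subst t (s x)"
  shows "subst t \<in> star_hom (free_star_alg s) (free_star_alg s')"
proof -
  have "subst t (star_ext s p) = star_ext s' (subst t p)" for p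
    by (induction p rule: free_alg_induct) (simp_all add: star_ext_simps subst_simps assms)
  moreover have "subst t 1 = 1" using subst_scal[of t 1] by simp
  ultimately show ?thesis
    by (auto simp: star_hom_def subst_simps intro!: ring_hom_memI)
qed

text \<open>The uniqueness half of the universal property. Applied to composites with the
  projections, it later shows that the two homomorphisms are mutually inverse.\<close>

lemma star_hom_free_eqI:
  assumes f: "f \<in> star_hom (free_star_alg s) B" and g: "g \<in> star_hom (free_star_alg s) B"
    and gen: "\<And>x. f (gen x) = g (gen x)"
  shows "f p = g p"
proof (induction p rule: free_alg_induct)
  case (scal c)
  have "h (scal c) = c \<odot>\<^bsub>B\<^esub> \<one>\<^bsub>B\<^esub>" if "h \<in> star_hom (free_star_alg s) B" for h
  proof -
    \<comment> \<open>A scalar is a multiple of the unit, so its image is determined by homogeneity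
      and \<open>h 1\<close>.\<close>
    have "h (c \<odot>\<^bsub>free_star_alg s\<^esub> 1) = c \<odot>\<^bsub>B\<^esub> h 1" "h 1 = \<one>\<^bsub>B\<^esub>"
      using that ring_hom_one[of h "free_star_alg s" B] by (simp_all add: star_hom_def del: free_star_alg_simps(6))
    then show ?thesis by simp
  qed
  from this[OF f] this[OF g] show ?case by simp
next
  case (mult p q)
  have "h (p * q) = h p \<otimes>\<^bsub>B\<^esub> h q" if "h \<in> star_hom (free_star_alg s) B" for h
    using that ring_hom_mult[of h "free_star_alg s" B p q] by (simp add: star_hom_def)
  from this[OF f] this[OF g] show ?case by (simp add: mult.IH)
next
  case (add p q)
  have "h (p + q) = h p \<oplus>\<^bsub>B\<^esub> h q" if "h \<in> star_hom (free_star_alg s) B" for h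
    using that ring_hom_add[of h "free_star_alg s" B p q] by (simp add: star_hom_def)
  from this[OF f] this[OF g] show ?case by (simp add: add.IH)
qed (rule gen)

text \<open>Closure rules in terms of the type class operations: membership then follows from
  writing an element as a combination of relations with coefficients on the left.\<close>

lemma genideal_free_star_alg:
  shows genideal_free_base: "r \<in> R \<Longrightarrow> r \<in> Idl\<^bsub>free_star_alg s\<^esub> R"
    and genideal_free_0: "0 \<in> Idl\<^bsub>free_star_alg s\<^esub> R"
    and genideal_free_add: "\<lbrakk>p \<in> Idl\<^bsub>free_star_alg s\<^esub> R; r \<in> Idl\<^bsub>free_star_alg s\<^esub> R\<rbrakk>
      \<Longrightarrow> p + r \<in> Idl\<^bsub>free_star_alg s\<^esub> R"
    and genideal_free_mult: "r \<in> Idl\<^bsub>free_star_alg s\<^esub> R \<Longrightarrow> p * r \<in> Idl\<^bsub>free_star_alg s\<^esub> R"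
proof -
  interpret ring "free_star_alg s" by (rule ring_free_star_alg)
  interpret I: ideal "Idl\<^bsub>free_star_alg s\<^esub> R" "free_star_alg s" by (rule genideal_ideal) simp
  show "r \<in> R \<Longrightarrow> r \<in> Idl\<^bsub>free_star_alg s\<^esub> R" using genideal_self[of R] by auto
  show "0 \<in> Idl\<^bsub>free_star_alg s\<^esub> R" using I.zero_closed by simp
  show "p + r \<in> Idl\<^bsub>free_star_alg s\<^esub> R"
    if "p \<in> Idl\<^bsub>free_star_alg s\<^esub> R" "r \<in> Idl\<^bsub>free_star_alg s\<^esub> R"
    using I.a_closed[OF that] by simp
  show "p * r \<in> Idl\<^bsub>free_star_alg s\<^esub> R" if "r \<in> Idl\<^bsub>free_star_alg s\<^esub> R"
    using I.I_l_closed[OF that, of p] by simp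
qed

text \<open>The first assumption makes the star of the free algebra an involution; the second makes
  it descend to the quotient.\<close>

locale star_presentation =
  fixes s :: "'g \<Rightarrow> 'g free_alg" and R :: "'g free_alg set"
  assumes star_star_gen: "star_ext s (s x) = gen x"
    and star_rel: "r \<in> R \<Longrightarrow> star_ext s r \<in> Idl\<^bsub>free_star_alg s\<^esub> R"
begin

sublocale free: star_algebra "free_star_alg s"
  by (rule star_algebra_free_star_alg) (rule star_star_gen)

sublocale rels: star_ideal "Idl\<^bsub>free_star_alg s\<^esub> R" "free_star_alg s"
  by (rule free.star_ideal_genideal) (simp_all add: star_rel)

abbreviation alg :: "'g free_alg set star_alg" where
  "alg \<equiv> presented_star_alg s R"

definition proj :: "'g free_alg \<Rightarrow> 'g free_alg set" where
  "proj p = (Idl\<^bsub>free_star_alg s\<^esub> R) +>\<^bsub>free_star_alg s\<^esub> p"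

lemma presented_gen_eq_proj: "presented_gen s R x = proj (gen x)"
  by (simp add: presented_gen_def proj_def)

sublocale alg: star_algebra alg
  unfolding presented_star_alg_def by (rule rels.star_algebra_star_quot)

lemma carrier_alg: "carrier alg = range proj"
  by (simp add: presented_star_alg_def rels.star_quot_simps proj_def)

lemma proj_star_hom: "proj \<in> star_hom (free_star_alg s) alg"
  using rels.coset_star_hom by (simp add: presented_star_alg_def proj_def[abs_def])

lemma proj_simps:
  "proj p \<in> carrier alg" "proj p \<ominus>\<^bsub>alg\<^esub> proj r = proj (p - r)" "\<ominus>\<^bsub>alg\<^esub> proj p = proj (- p)"
  "c \<odot>\<^bsub>alg\<^esub> proj p = proj (scal c * p)" "star alg (proj p) = proj (star_ext s p)"
proof -
  have hom: "proj \<in> ring_hom (free_star_alg s) alg"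
    using proj_star_hom by (simp add: star_hom_def)
  have carr: "proj p \<in> carrier alg" for p by (simp add: carrier_alg)
  have add: "proj p \<oplus>\<^bsub>alg\<^esub> proj r = proj (p + r)" for p r
    using ring_hom_add[OF hom, of p r] by simp
  have "proj 0 = \<zero>\<^bsub>alg\<^esub>"
    using ring_hom_zero[OF hom free.ring_axioms alg.ring_axioms] by simp
  then show inv: "\<ominus>\<^bsub>alg\<^esub> proj p = proj (- p)" for p
    by (intro alg.minus_equality) (simp_all add: add carr)
  show "proj p \<ominus>\<^bsub>alg\<^esub> proj r = proj (p - r)"
    by (simp add: a_minus_def inv add)
  show "proj p \<in> carrier alg" by (rule carr)
  show "c \<odot>\<^bsub>alg\<^esub> proj p = proj (scal c * p)" "star alg (proj p) = proj (star_ext s p)"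
    using proj_star_hom by (simp_all add: star_hom_def)
qed

lemma proj_rel: "r \<in> Idl\<^bsub>free_star_alg s\<^esub> R \<Longrightarrow> proj r = \<zero>\<^bsub>alg\<^esub>"
  by (simp add: presented_star_alg_def proj_def rels.coset_mem)

text \<open>The existence half of the universal property of a presentation.\<close>

lemma alg_hom_exists:
  assumes B: "star_algebra B" and f: "f \<in> star_hom (free_star_alg s) B"
    and zero: "\<And>r. r \<in> R \<Longrightarrow> f r = \<zero>\<^bsub>B\<^esub>"
  shows "\<exists>F \<in> star_hom alg B. \<forall>p. F (proj p) = f p"
proof -
  have zero': "f r = \<zero>\<^bsub>B\<^esub>" if "r \<in> Idl\<^bsub>free_star_alg s\<^esub> R" for r
    using star_hom_genideal_zero[OF free.star_algebra_axioms B f _ zero that] by simp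
  show ?thesis
    using rels.lift_star_hom[OF f B zero'] rels.lift_coset[OF f B zero']
    by (auto simp: presented_star_alg_def proj_def intro!: bexI[of _ "rels.lift f"])
qed

end


section \<open>The quotients of the q-Minkowski algebra\<close>

lemmas free_alg_normalize =
  algebra_simps scal_add scal_diff scal_minus scal_simps

lemma star_presentation_mink:
  assumes q: "q \<noteq> 0"
  shows "star_presentation (mink_star q) (mink_rels q)"
proof
  show "star_ext (mink_star q) (mink_star q x) = gen x" for x
    using q by (cases x) (simp_all add: star_ext_simps scal_simps mult.assoc)
next
  fix r assume "r \<in> mink_rels q"
  \<comment> \<open>Named relations stay opaque in the membership search, which then sees only their
    combinations.\<close>
  define r1 where "r1 = gen X1 * gen X2 - scal q * gen X2 * gen X1"
  define r2 where "r2 = gen X1 * gen X3 - scal q * gen X3 * gen X1"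
  define r3 where "r3 = gen X2 * gen X4 - scal q * gen X4 * gen X2"
  define r4 where "r4 = gen X3 * gen X4 - scal q * gen X4 * gen X3"
  define r5 where "r5 = gen X2 * gen X3 - gen X3 * gen X2"
  define r6 where "r6 = gen X1 * gen X4 - (gen X4 * gen X1 - scal (q - inverse q) * gen X2 * gen X3)"
  note r_defs = r1_def r2_def r3_def r4_def r5_def r6_def
  have R: "mink_rels q = {r1, r2, r3, r4, r5, r6}" by (simp add: mink_rels_def r_defs)
  let ?st = "star_ext (mink_star q)"
  \<comment> \<open>The star exchanges \<open>x1\<close> and \<open>x4\<close> up to scalars, hence
    \<open>r1\<close> with \<open>r3\<close> and \<open>r2\<close> with \<open>r4\<close>. In
    \<open>r6\<close> it turns \<open>x2 x3\<close> into \<open>x3 x2\<close>, and \<open>r5\<close>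
    repairs the order.\<close>
  have "?st r1 = scal q * r3" "?st r2 = scal q * r4"
    "?st r3 = scal (inverse q) * r1" "?st r4 = scal (inverse q) * r2"
    "?st r5 = scal (- 1) * r5" "?st r6 = r6 + scal (inverse q - q) * r5"
    using q by (simp_all add: r_defs star_ext_simps free_alg_normalize)
  then show "?st r \<in> Idl\<^bsub>free_star_alg (mink_star q)\<^esub> mink_rels q"
    using \<open>r \<in> mink_rels q\<close> unfolding R
    by (auto intro!: genideal_free_add genideal_free_mult intro: genideal_free_base)
qed

text \<open>
  The two cases are treated at once: \<open>e = 1\<close> gives the euclidean plane and \<open>e = -1\<close> the
  plane of \<open>SOq(2,1)\<close>; the relation divided out is \<open>x2 = e x3\<close>, and \<open>k x2\<close> is identified with \<open>y2\<close>.
\<close>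

locale mink_quotient =
  fixes q :: real and e k :: complex and sY :: "ygen \<Rightarrow> ygen free_alg"
  assumes q: "q > 0" and e: "e = 1 \<or> e = - 1"
    and k: "cnj k = e * k" "k * k = e * (sqrt q + inverse (sqrt q))"
    and sY: "sY Y1 = scal q * gen Y3" "sY Y2 = scal e * gen Y2" "sY Y3 = scal (inverse q) * gen Y1"
begin

lemma ee: "e * e = 1" "cnj e = e" "e \<noteq> 0"
  using e by auto

lemma k_nonzero: "k \<noteq> 0"
proof
  assume "k = 0"
  then have "complex_of_real (sqrt q + inverse (sqrt q)) = 0" using k(2) ee(3) by simp
  moreover have "sqrt q + inverse (sqrt q) > 0" using q by (simp add: add_pos_pos)
  ultimately show False by (simp only: of_real_eq_0_iff)
qed

text \<open>This matches the coefficients of the two last relations. It is used as it stands for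
  \<open>to_X\<close> and divided by \<open>k * k\<close> for \<open>to_Y\<close>.\<close>

lemma coeff: "k * k * complex_of_real (sqrt q - inverse (sqrt q)) = e * complex_of_real (q - inverse q)"
proof -
  have "(sqrt q + inverse (sqrt q)) * (sqrt q - inverse (sqrt q)) = q - inverse q"
    using q by (simp add: algebra_simps flip: inverse_mult_distrib)
  then show ?thesis unfolding k(2) by (metis mult.assoc of_real_mult)
qed

sublocale X: star_presentation "mink_star q" "mink_rels q"
  using q by (intro star_presentation_mink) simp

sublocale Y: star_presentation sY "so3_rels q"
proof
  show "star_ext sY (sY y) = gen y" for y
    using q ee by (cases y) (simp_all add: sY star_ext_simps scal_simps mult.assoc)
next
  fix r assume "r \<in> so3_rels q"
  define r1 where "r1 = gen Y1 * gen Y2 - scal q * gen Y2 * gen Y1"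
  define r2 where "r2 = gen Y2 * gen Y3 - scal q * gen Y3 * gen Y2"
  define r3 where "r3 = gen Y1 * gen Y3 -
    (gen Y3 * gen Y1 - scal (sqrt q - inverse (sqrt q)) * gen Y2 * gen Y2)"
  note r_defs = r1_def r2_def r3_def
  have R: "so3_rels q = {r1, r2, r3}" by (simp add: so3_rels_def r_defs)
  let ?st = "star_ext sY"
  \<comment> \<open>\<open>r3\<close> is fixed because its coefficient is real and the two signs
    \<open>e\<close> from \<open>y2 y2\<close> cancel.\<close>
  have "?st r1 = scal (e * q) * r2" "?st r2 = scal (e * inverse q) * r1" "?st r3 = r3"
    using q e by (auto simp: r_defs sY star_ext_simps free_alg_normalize)
  then show "?st r \<in> Idl\<^bsub>free_star_alg sY\<^esub> so3_rels q"
    using \<open>r \<in> so3_rels q\<close> unfolding R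
    by (auto intro!: genideal_free_mult intro: genideal_free_base)
qed

definition I where "I = rel_ideal X.alg (X.proj (gen X2)) (X.proj (scal e * gen X3))"

sublocale I: star_ideal I X.alg
  unfolding I_def rel_ideal_def
proof (rule X.alg.star_ideal_genideal)
  fix x assume "x \<in> {X.proj (gen X2) \<ominus>\<^bsub>X.alg\<^esub> X.proj (scal e * gen X3)}"
  \<comment> \<open>\<open>x2\<close> and \<open>x3\<close> are self-adjoint and \<open>e\<close> is
    real, so the generator of the ideal is itself self-adjoint.\<close>
  then have "star X.alg x = X.proj (gen X2) \<ominus>\<^bsub>X.alg\<^esub> X.proj (scal e * gen X3)"
    by (simp add: X.proj_simps star_ext_simps ee scal_simps)
  then show "star X.alg x \<in> Idl\<^bsub>X.alg\<^esub> {X.proj (gen X2) \<ominus>\<^bsub>X.alg\<^esub> X.proj (scal e * gen X3)}"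
    by (simp add: X.alg.genideal_self' X.proj_simps)
qed (simp add: X.proj_simps)

abbreviation Q where "Q \<equiv> star_quot X.alg I"

sublocale Q: star_algebra Q
  by (rule I.star_algebra_star_quot)

definition quot where "quot p = I +>\<^bsub>X.alg\<^esub> X.proj p"

lemma quot_star_hom: "quot \<in> star_hom (free_star_alg (mink_star q)) Q"
  using star_hom_comp[OF X.proj_star_hom I.coset_star_hom] by (simp add: comp_def quot_def[abs_def])

lemma carrier_Q: "carrier Q = range quot"
  by (auto simp: I.star_quot_simps X.carrier_alg quot_def)

text \<open>The quotient is taken in two steps, but it kills the ideal of the one-step presentation
  with \<open>x2 - e x3\<close> adjoined. Calculations can therefore stay in the free
  algebra.\<close>

lemma quot_zero:
  assumes "p \<in> Idl\<^bsub>free_star_alg (mink_star q)\<^esub> insert (gen X2 - scal e * gen X3) (mink_rels q)"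
  shows "quot p = \<zero>\<^bsub>Q\<^esub>"
proof (rule star_hom_genideal_zero[OF X.free.star_algebra_axioms Q.star_algebra_axioms quot_star_hom _ _ assms])
  fix r assume "r \<in> insert (gen X2 - scal e * gen X3) (mink_rels q)"
  then consider "r = gen X2 - scal e * gen X3" | "r \<in> mink_rels q" by auto
  then have "X.proj r \<in> I"
  proof cases
    case 1
    then show ?thesis
      by (simp add: I_def rel_ideal_def X.proj_simps X.alg.genideal_self')
  next
    case 2
    then show ?thesis by (simp add: X.proj_rel genideal_free_base)
  qed
  then show "quot r = \<zero>\<^bsub>Q\<^esub>"
    by (simp add: quot_def I.coset_mem)
qed simp

text \<open>The value at \<open>X3\<close> comes from \<open>x3 = e x2\<close>, which is
  \<open>x2 = e x3\<close> multiplied by \<open>e\<close>.\<close>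

fun to_Y :: "xgen \<Rightarrow> ygen free_alg" where
  "to_Y X1 = gen Y1"
| "to_Y X2 = scal (inverse k) * gen Y2"
| "to_Y X3 = scal (e * inverse k) * gen Y2"
| "to_Y X4 = gen Y3"

fun to_X :: "ygen \<Rightarrow> xgen free_alg" where
  "to_X Y1 = gen X1"
| "to_X Y2 = scal k * gen X2"
| "to_X Y3 = gen X4"

lemma subst_to_Y_rel:
  assumes "r \<in> mink_rels q"
  shows "subst to_Y r \<in> Idl\<^bsub>free_star_alg sY\<^esub> so3_rels q"
proof -
  define r1 where "r1 = gen Y1 * gen Y2 - scal q * gen Y2 * gen Y1"
  define r2 where "r2 = gen Y2 * gen Y3 - scal q * gen Y3 * gen Y2"
  define r3 where "r3 = gen Y1 * gen Y3 -
    (gen Y3 * gen Y1 - scal (sqrt q - inverse (sqrt q)) * gen Y2 * gen Y2)"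
  note r_defs = r1_def r2_def r3_def
  have R: "so3_rels q = {r1, r2, r3}" by (simp add: so3_rels_def r_defs)
  \<comment> \<open>This is \<open>coeff\<close> solved for the coefficient in \<open>r3\<close>, in
    the shape produced by substituting \<open>y2/k\<close> and \<open>e y2/k\<close> into
    \<open>x2 x3\<close>, so that the image of the last relation is exactly
    \<open>r3\<close>.\<close>
  have "complex_of_real (sqrt q - inverse (sqrt q)) = complex_of_real (q - inverse q) * (inverse k * (e * inverse k))"
    using coeff k_nonzero by (simp add: field_simps)
  then have r3': "r3 = gen Y1 * gen Y3 -
    (gen Y3 * gen Y1 - scal (complex_of_real (q - inverse q) * (inverse k * (e * inverse k))) * gen Y2 * gen Y2)"
    unfolding r3_def by (simp only:)
  have
    "subst to_Y (gen X1 * gen X2 - scal q * gen X2 * gen X1) = scal (inverse k) * r1"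
    "subst to_Y (gen X1 * gen X3 - scal q * gen X3 * gen X1) = scal (e * inverse k) * r1"
    "subst to_Y (gen X2 * gen X4 - scal q * gen X4 * gen X2) = scal (inverse k) * r2"
    "subst to_Y (gen X3 * gen X4 - scal q * gen X4 * gen X3) = scal (e * inverse k) * r2"
    "subst to_Y (gen X2 * gen X3 - gen X3 * gen X2) = 0"
    "subst to_Y (gen X1 * gen X4 - (gen X4 * gen X1 - scal (q - inverse q) * gen X2 * gen X3)) = r3"
    by (simp_all add: r1_def r2_def r3' subst_simps free_alg_normalize)
  then show ?thesis
    using assms unfolding mink_rels_def R
    by (auto intro!: genideal_free_mult genideal_free_0 intro: genideal_free_base)
qed

text \<open>The last relation uses \<open>x1 x4 - x4 x1 + (q - 1/q) e x2 x2 =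
  (x1 x4 - x4 x1 + (q - 1/q) x2 x3) + (q - 1/q) e x2 (x2 - e x3)\<close>, as \<open>e e = 1\<close>.\<close>

lemma subst_to_X_rel:
  assumes "r \<in> so3_rels q"
  shows "subst to_X r \<in>
    Idl\<^bsub>free_star_alg (mink_star q)\<^esub> insert (gen X2 - scal e * gen X3) (mink_rels q)"
proof -
  define r0 where "r0 = gen X2 - scal e * gen X3"
  define r1 where "r1 = gen X1 * gen X2 - scal q * gen X2 * gen X1"
  define r3 where "r3 = gen X2 * gen X4 - scal q * gen X4 * gen X2"
  define r6 where "r6 = gen X1 * gen X4 - (gen X4 * gen X1 - scal (q - inverse q) * gen X2 * gen X3)"
  note r_defs = r0_def r1_def r3_def r6_def
  have R: "{r0, r1, r3, r6} \<subseteq> insert (gen X2 - scal e * gen X3) (mink_rels q)"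
    by (auto simp: mink_rels_def r_defs)
  have "subst to_X (gen Y1 * gen Y3 -
        (gen Y3 * gen Y1 - scal (sqrt q - inverse (sqrt q)) * gen Y2 * gen Y2)) =
      gen X1 * gen X4 - gen X4 * gen X1
        + scal (k * k * complex_of_real (sqrt q - inverse (sqrt q))) * (gen X2 * gen X2)"
    by (simp add: subst_simps free_alg_normalize)
  also have "\<dots> = r6 + scal (e * complex_of_real (q - inverse q)) * (gen X2 * r0)"
    unfolding coeff r_defs using e by (auto simp: free_alg_normalize)
  finally have "subst to_X (gen Y1 * gen Y3 -
        (gen Y3 * gen Y1 - scal (sqrt q - inverse (sqrt q)) * gen Y2 * gen Y2)) =
      r6 + scal (e * complex_of_real (q - inverse q)) * (gen X2 * r0)" .
  moreover have
    "subst to_X (gen Y1 * gen Y2 - scal q * gen Y2 * gen Y1) = scal k * r1"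
    "subst to_X (gen Y2 * gen Y3 - scal q * gen Y3 * gen Y2) = scal k * r3"
    by (simp_all add: r_defs subst_simps free_alg_normalize)
  ultimately show ?thesis
    using assms R unfolding so3_rels_def
    by (auto intro!: genideal_free_add genideal_free_mult intro: genideal_free_base)
qed

lemma quotient_iso:
  "\<exists>f \<in> star_alg_iso Q Y.alg.
     f (quot (gen X1)) = Y.proj (gen Y1) \<and> f (quot (scal k * gen X2)) = Y.proj (gen Y2) \<and>
     f (quot (gen X4)) = Y.proj (gen Y3)"
proof -
  have sub_Y: "subst to_Y \<in> star_hom (free_star_alg (mink_star q)) (free_star_alg sY)"
  proof (rule subst_star_hom)
    show "star_ext sY (to_Y x) = subst to_Y (mink_star q x)" for x
      \<comment> \<open>At \<open>X2\<close>, \<open>cnj k = e k\<close> gives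
        \<open>1 / (e k)\<close> as conjugate of \<open>1/k\<close>; the sign cancels against that
        of the star of \<open>y2\<close>, and \<open>y2/k\<close> is self-adjoint like
        \<open>x2\<close>.\<close>
      using e by (cases x) (auto simp: sY star_ext_simps subst_simps scal_simps k mult.assoc)
  qed
  have sub_X: "subst to_X \<in> star_hom (free_star_alg sY) (free_star_alg (mink_star q))"
  proof (rule subst_star_hom)
    show "star_ext (mink_star q) (to_X y) = subst to_X (sY y)" for y
      by (cases y) (simp_all add: sY star_ext_simps subst_simps scal_simps k)
  qed
  have Yhom: "Y.proj \<circ> subst to_Y \<in> star_hom (free_star_alg (mink_star q)) Y.alg"
    by (rule star_hom_comp[OF sub_Y Y.proj_star_hom])
  have "(Y.proj \<circ> subst to_Y) r = \<zero>\<^bsub>Y.alg\<^esub>" if "r \<in> mink_rels q" for r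
    using subst_to_Y_rel[OF that] by (simp add: Y.proj_rel)
  from X.alg_hom_exists[OF Y.alg.star_algebra_axioms Yhom this]
  obtain F0 where F0: "F0 \<in> star_hom X.alg Y.alg" "\<And>p. F0 (X.proj p) = Y.proj (subst to_Y p)"
    by auto
  \<comment> \<open>Only the generator of \<open>I\<close> matters: its image is
    \<open>y2/k - e e y2/k = 0\<close>.\<close>
  have F0_zero: "F0 x = \<zero>\<^bsub>Y.alg\<^esub>" if "x \<in> I" for x
    using that unfolding I_def rel_ideal_def
  proof (rule star_hom_genideal_zero[OF X.alg.star_algebra_axioms Y.alg.star_algebra_axioms F0(1), rotated 2])
    show "F0 x = \<zero>\<^bsub>Y.alg\<^esub>" if "x \<in> {X.proj (gen X2) \<ominus>\<^bsub>X.alg\<^esub> X.proj (scal e * gen X3)}" for x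
      using that ee by (auto simp: X.proj_simps F0(2) subst_simps scal_simps mult.assoc[symmetric, of e]
          Y.proj_rel genideal_free_0)
  qed (simp add: X.proj_simps)
  define F where "F = I.lift F0"
  have F: "F \<in> star_hom Q Y.alg"
    unfolding F_def by (rule I.lift_star_hom[OF F0(1) Y.alg.star_algebra_axioms F0_zero])
  have F_quot: "F (quot p) = Y.proj (subst to_Y p)" for p
    unfolding F_def quot_def F0(2)[symmetric]
    by (rule I.lift_coset[OF F0(1) Y.alg.star_algebra_axioms F0_zero X.proj_simps(1)])
  have Xhom: "quot \<circ> subst to_X \<in> star_hom (free_star_alg sY) Q"
    by (rule star_hom_comp[OF sub_X quot_star_hom])
  have "(quot \<circ> subst to_X) r = \<zero>\<^bsub>Q\<^esub>" if "r \<in> so3_rels q" for r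
    using subst_to_X_rel[OF that] by (simp add: quot_zero)
  from Y.alg_hom_exists[OF Q.star_algebra_axioms Xhom this]
  obtain G where G: "G \<in> star_hom Y.alg Q" "\<And>p. G (Y.proj p) = quot (subst to_X p)"
    by auto
  have Y2: "subst to_Y (scal k * gen X2) = gen Y2"
    using k_nonzero by (simp add: subst_simps scal_simps)
  have FG: "F (G (Y.proj p)) = Y.proj p" for p
  proof -
    have "(F \<circ> (G \<circ> Y.proj)) (gen y) = Y.proj (gen y)" for y
      by (cases y) (simp_all add: G F_quot Y2 subst_gen)
    from star_hom_free_eqI[OF star_hom_comp[OF star_hom_comp[OF Y.proj_star_hom G(1)] F] Y.proj_star_hom this]
    show ?thesis by simp
  qed
  \<comment> \<open>\<open>X3\<close> is the one generator that the round trip moves inside the free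
    algebra: it becomes \<open>e x2\<close>, which equals \<open>x3\<close> only in the
    quotient.\<close>
  have X3: "quot (scal e * gen X2) = quot (gen X3)"
  proof -
    have "gen X3 - scal e * gen X2 = scal (- e) * (gen X2 - scal e * gen X3)"
      using ee by (simp add: free_alg_normalize)
    then have "quot (gen X3 - scal e * gen X2) = \<zero>\<^bsub>Q\<^esub>"
      by (simp add: quot_zero genideal_free_mult genideal_free_base)
    moreover have "quot (p + r) = quot p \<oplus>\<^bsub>Q\<^esub> quot r" for p r
      using quot_star_hom ring_hom_add[of quot "free_star_alg (mink_star q)" Q p r]
      by (simp add: star_hom_def)
    ultimately show ?thesis
      using Q.l_zero[of "quot (scal e * gen X2)"] carrier_Q by (metis diff_add_cancel rangeI)
  qed
  have GF: "G (F (quot p)) = quot p" for p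
  proof -
    have "(G \<circ> (F \<circ> quot)) (gen x) = quot (gen x)" for x
      using k_nonzero X3
      by (cases x) (simp_all add: G F_quot subst_simps scal_simps mult.assoc)
    from star_hom_free_eqI[OF star_hom_comp[OF star_hom_comp[OF quot_star_hom F] G(1)] quot_star_hom this]
    show ?thesis by simp
  qed
  have "F \<in> star_alg_iso Q Y.alg"
    by (rule star_alg_isoI[OF Q.star_algebra_axioms Y.alg.star_algebra_axioms F G(1)])
      (use GF FG in \<open>auto simp: carrier_Q Y.carrier_alg\<close>)
  then show ?thesis by (intro bexI[of _ F]) (simp_all add: F_quot Y2 subst_gen)
qed

lemma mink_quotient_iso:
  defines "M \<equiv> mink_plane q" and "x \<equiv> mink_x q"
  defines "J \<equiv> rel_ideal M (x X2) (e \<odot>\<^bsub>M\<^esub> x X3)"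
  shows "\<exists>f \<in> star_alg_iso (star_quot M J) (presented_star_alg sY (so3_rels q)).
     f (J +>\<^bsub>M\<^esub> x X1) = presented_gen sY (so3_rels q) Y1 \<and>
     f (J +>\<^bsub>M\<^esub> (k \<odot>\<^bsub>M\<^esub> x X2)) = presented_gen sY (so3_rels q) Y2 \<and>
     f (J +>\<^bsub>M\<^esub> x X4) = presented_gen sY (so3_rels q) Y3"
proof -
  have M: "M = X.alg" by (simp add: M_def mink_plane_def)
  have x: "x g = X.proj (gen g)" for g by (simp add: x_def mink_x_def X.presented_gen_eq_proj)
  have J: "J = I" by (simp add: J_def I_def M x X.proj_simps)
  show ?thesis
    using quotient_iso unfolding M x J Y.presented_gen_eq_proj quot_def X.proj_simps .
qed

end

theorem mainTheorem8:
  fixes q :: real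
  assumes "q > 0"
  shows
    "let M = mink_plane q; x = mink_x q;
         c = complex_of_real (sqrt (sqrt q + inverse (sqrt q)));
         I = rel_ideal M (x X2) (x X3);
         J = rel_ideal M (x X2) (\<ominus>\<^bsub>M\<^esub> x X3)
     in (\<exists>f \<in> star_alg_iso (star_quot M I) (eucl_plane q).
           f (I +>\<^bsub>M\<^esub> x X1) = eucl_y q Y1 \<and>
           f (I +>\<^bsub>M\<^esub> (c \<odot>\<^bsub>M\<^esub> x X2)) = eucl_y q Y2 \<and>
           f (I +>\<^bsub>M\<^esub> x X4) = eucl_y q Y3) \<and>
        (\<exists>f \<in> star_alg_iso (star_quot M J) (lor_plane q).
           f (J +>\<^bsub>M\<^esub> x X1) = lor_y q Y1 \<and>
           f (J +>\<^bsub>M\<^esub> ((\<i> * c) \<odot>\<^bsub>M\<^esub> x X2)) = lor_y q Y2 \<and>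
           f (J +>\<^bsub>M\<^esub> x X4) = lor_y q Y3)"
proof -
  let ?c = "complex_of_real (sqrt (sqrt q + inverse (sqrt q)))"
  let ?M = "mink_plane q"
  interpret X: star_presentation "mink_star q" "mink_rels q"
    using assms by (intro star_presentation_mink) simp
  \<comment> \<open>Turns the uniform \<open>e x3\<close> into the forms of the relation used in the
    two claims.\<close>
  have x3: "1 \<odot>\<^bsub>?M\<^esub> mink_x q X3 = mink_x q X3" "(- 1) \<odot>\<^bsub>?M\<^esub> mink_x q X3 = \<ominus>\<^bsub>?M\<^esub> mink_x q X3"
    by (simp_all add: mink_plane_def mink_x_def X.presented_gen_eq_proj X.proj_simps scal_minus)
  have "sqrt q + inverse (sqrt q) \<ge> 0" using assms by simp
  then have cc: "?c * ?c = sqrt q + inverse (sqrt q)"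
    by (simp only: flip: of_real_mult) simp
  have E: "mink_quotient q 1 ?c (eucl_star q)"
    using assms cc by unfold_locales simp_all
  \<comment> \<open>The factor \<open>\<i>\<close> supplies both signs required for
    \<open>e = -1\<close>: the square becomes negative and conjugation changes the sign of
    \<open>k\<close>.\<close>
  have "(\<i> * ?c) * (\<i> * ?c) = - (?c * ?c)" by (simp add: algebra_simps)
  then have L: "mink_quotient q (- 1) (\<i> * ?c) (lor_star q)"
    using assms cc by unfold_locales (simp_all add: scal_minus)
  show ?thesis
    using mink_quotient.mink_quotient_iso[OF E] mink_quotient.mink_quotient_iso[OF L]
    unfolding Let_def x3 eucl_plane_def eucl_y_def lor_plane_def lor_y_def by (rule conjI)
qed

end
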